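(* Suppose $X=\{X_1,\dots,X_m\}$ and $Y=\{Y_1,\dots,Y_{m'}\}$ are $\eta$-coplanar for some $\eta\in\mathbb{R}^s$ and that they define the same directional growth function. Then $m=m'$ and $X$ is a permutation of $Y$.
   Context: Let $s\ge 1$. A finite family of integral vectors $X=\{X_1,\dots,X_m\}\subset\mathbb{Z}^s$ (repetitions allowed) is assumed to lie in an open half-space, i.e. there is $\alpha\in\mathbb{R}^s$ with $\langle X_j,\alpha\rangle>0$ for all $j$, and to span $\mathbb{R}^s$. Let $\mathbf{C}_X=X_1\mathbb{R}^++\cdots+X_m\mathbb{R}^+$ be the convex cone and $\mathcal{J}_X=X_1\mathbb{N}+\cdots+X_m\mathbb{N}$ the additive semi-group generated by $X$. For $z\in\mathcal{J}_X$, the multiplicity $\mathbf{m}_X(z)$ is the number of words $i_1\dots i_n$ over $\{1,\dots,m\}$ (any $n\ge 0$) with $X_{i_1}+\cdots+X_{i_n}=z$; for $x\in\mathbf{C}_X$ one sets $\mathbf{m}_X(x)=\min\{\mathbf{m}_X(z): z\in\mathcal{J}_X,\ \|x-z\|=d(x,\mathcal{J}_X)\}$. The directional growth function is $\gamma_X(\theta)=\lim_{k\to\infty}\frac{1}{k}\log\mathbf{m}_X(k\theta)$ for unit vectors $\theta\in\mathbf{C}_X$ (the limit exists). Two such families $X$ and $Y$ are said to define the same directional growth function if $\mathbf{C}_X=\mathbf{C}_Y$ and $\gamma_X=\gamma_Y$. The family $X$ is called $\eta$-coplanar if $\langle \eta, X_j\rangle=1$ for all $j=1,\dots,m$. *)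

theory Defs
  imports "HOL-Analysis.Analysis" "HOL-Combinatorics.Permutations"
begin

text \<open>A finite family with repetitions is a list of vectors. Integral vectors are vectors of
  \<open>real ^ 'n\<close> with integer coordinates; the dimension is \<open>CARD('n) \<ge> 1\<close>.\<close>

definition admissible_family :: "(real ^ 'n) list \<Rightarrow> bool" where
  "admissible_family X \<longleftrightarrow>
     (\<forall>x\<in>set X. \<forall>i. x $ i \<in> \<int>) \<and>
     (\<exists>\<alpha>. \<forall>x\<in>set X. x \<bullet> \<alpha> > 0) \<and>
     span (set X) = UNIV"

definition family_cone :: "(real ^ 'n) list \<Rightarrow> (real ^ 'n) set" where
  "family_cone X =
     {\<Sum>j<length X. c j *\<^sub>R X ! j | c :: nat \<Rightarrow> real. \<forall>j<length X. c j \<ge> 0}"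

definition family_semigroup :: "(real ^ 'n) list \<Rightarrow> (real ^ 'n) set" where
  "family_semigroup X =
     {\<Sum>j<length X. real (a j) *\<^sub>R X ! j | a :: nat \<Rightarrow> nat. True}"

text \<open>Words are words in the indices, so equal vectors at different positions are different
  letters. For a family in an open half-space the set of words counted is finite.\<close>

definition word_mult :: "(real ^ 'n) list \<Rightarrow> real ^ 'n \<Rightarrow> nat" where
  "word_mult X z =
     card {w :: nat list. set w \<subseteq> {..<length X} \<and> sum_list (map (\<lambda>i. X ! i) w) = z}"

text \<open>The extension of the multiplicity from the semigroup to the cone. The infimum is over a
  nonempty set of natural numbers, hence a minimum: the semigroup contains \<open>0\<close> and consists of
  integral vectors, so nearest points exist.\<close>

definition cone_mult :: "(real ^ 'n) list \<Rightarrow> real ^ 'n \<Rightarrow> nat" where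
  "cone_mult X x =
     Inf {word_mult X z | z.
            z \<in> family_semigroup X \<and> norm (x - z) = infdist x (family_semigroup X)}"

definition dir_growth :: "(real ^ 'n) list \<Rightarrow> real ^ 'n \<Rightarrow> real" where
  "dir_growth X \<theta> = lim (\<lambda>k::nat. 1 / real k * ln (real (cone_mult X (real k *\<^sub>R \<theta>))))"

text \<open>The growth function has the unit vectors of the cone as its domain.\<close>

definition same_dir_growth :: "(real ^ 'n) list \<Rightarrow> (real ^ 'n) list \<Rightarrow> bool" where
  "same_dir_growth X Y \<longleftrightarrow>
     family_cone X = family_cone Y \<and>
     (\<forall>\<theta>\<in>family_cone X. norm \<theta> = 1 \<longrightarrow> dir_growth X \<theta> = dir_growth Y \<theta>)"

definition eta_coplanar :: "real ^ 'n \<Rightarrow> (real ^ 'n) list \<Rightarrow> bool" where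
  "eta_coplanar \<eta> X \<longleftrightarrow> (\<forall>x\<in>set X. \<eta> \<bullet> x = 1)"

end

theory Submission
  imports Defs "HOL-Real_Asymp.Real_Asymp"
begin

text \<open>
  Put \<open>Z\<^sub>X(b) = \<Sum>\<^sub>j exp (b \<bullet> X\<^sub>j)\<close>. Expanding \<open>Z\<^sub>X(b) ^ n\<close> over words of length \<open>n\<close> gives
  \<open>\<Sum> m\<^sub>X(z) exp (b \<bullet> z) = Z\<^sub>X(b) ^ n\<close>, the sum being over the semigroup elements with
  \<open>\<eta> \<bullet> z = n\<close>. Hence \<open>ln m\<^sub>X(z) \<le> n ln Z\<^sub>X(b) - b \<bullet> z\<close> always, and as the sum has only
  polynomially many terms, some \<open>z\<close> attains this bound up to \<open>O(ln n)\<close>. Adding \<open>\<Sum>\<^sub>j X\<^sub>j\<close> moves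
  this \<open>z\<close> into the interior of the cone. At interior directions the growth limit exists by a shifted
  Fekete lemma, it dominates \<open>ln m\<^sub>X(z)\<close> by supermultiplicativity of \<open>m\<^sub>X\<close>, and it is bounded
  by the upper estimate for \<open>Y\<close> if the growth functions agree. Letting \<open>n \<rightarrow> \<infinity>\<close> gives
  \<open>Z\<^sub>X \<le> Z\<^sub>Y\<close>, by symmetry \<open>Z\<^sub>X = Z\<^sub>Y\<close>, and an exponential sum determines its frequencies.
\<close>

section \<open>Superadditive sequences with a shift\<close>

text \<open>The sequence \<open>u (n - r)\<close>, taken for \<open>n \<ge> r\<close>, is
  superadditive in the usual sense. So Fekete's argument applies to the quotients
  \<open>u k / (k + r)\<close>: the linear bound makes their supremum finite, and this supremum is
  the limit.\<close>

lemma fekete_shifted: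
  fixes u :: "nat \<Rightarrow> real"
  assumes super: "\<And>k l. u k + u l \<le> u (k + l + r)" and r: "r > 0"
    and nonneg: "\<And>k. 0 \<le> u k"
    and linear: "\<And>k. u k \<le> A * real k + B"
  shows "convergent (\<lambda>k. 1 / real k * u k)"
proof -
  define g where "g k = u k / real (k + r)" for k
  define L where "L = (SUP k. g k)"
  have bdd: "bdd_above (range g)"
  proof (rule bdd_aboveI2)
    fix k
    have "u k \<le> \<bar>A\<bar> * real k + \<bar>B\<bar> * 1"
      using linear[of k] by (smt (verit) mult_right_mono of_nat_0_le_iff)
    also have "\<dots> \<le> \<bar>A\<bar> * real (k + r) + \<bar>B\<bar> * real (k + r)"
      using r by (intro add_mono mult_left_mono) auto
    finally show "g k \<le> \<bar>A\<bar> + \<bar>B\<bar>"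
      using r by (simp add: g_def divide_le_eq distrib_right)
  qed
  have upper: "u k \<le> L * real (k + r)" for k
    using cSUP_upper[OF _ bdd, of k] r by (simp add: L_def g_def divide_le_eq)
  have iterate: "real q * u k + u l \<le> u (q * (k + r) + l)" for q k l
  proof (induction q)
    case (Suc q)
    have "real (Suc q) * u k + u l \<le> u k + u (q * (k + r) + l)"
      using Suc by (simp add: algebra_simps)
    also have "\<dots> \<le> u (k + (q * (k + r) + l) + r)"
      by (rule super)
    finally show ?case
      by (simp add: algebra_simps)
  qed simp
  \<comment> \<open>Cut \<open>n\<close> into \<open>n div (k + r)\<close> blocks, each worth
    \<open>u k\<close>, and a nonnegative remainder. Rounding the number of blocks down loses at
    most one \<open>u k\<close>, which is negligible after division by \<open>n\<close>.\<close>
  have lower: "g k - u k / real n \<le> 1 / real n * u n" if "n > 0" for k n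
  proof -
    let ?p = "k + r"
    have "real n = real (n div ?p) * real ?p + real (n mod ?p)"
      by (metis div_mult_mod_eq of_nat_add of_nat_mult)
    moreover have "real (n mod ?p) \<le> real ?p"
      using r mod_less_divisor[of ?p n] by linarith
    ultimately have "real n / real ?p - 1 \<le> real (n div ?p)"
      using r by (simp add: field_simps)
    then have "(real n / real ?p - 1) * u k \<le> real (n div ?p) * u k"
      by (rule mult_right_mono[OF _ nonneg])
    also have "\<dots> \<le> u n"
      using iterate[of "n div ?p" k "n mod ?p"] nonneg[of "n mod ?p"]
      unfolding div_mult_mod_eq by simp
    finally have "(real n / real ?p - 1) * u k / real n \<le> u n / real n"
      by (rule divide_right_mono) simp
    then show ?thesis
      using that r by (simp add: g_def field_simps)
  qed
  have "(\<lambda>k. 1 / real k * u k) \<longlonglongrightarrow> L"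
  proof (rule order_tendstoI)
    fix a assume "a < L"
    then obtain k where k: "a < g k"
      unfolding L_def using less_cSUP_iff[OF _ bdd] by auto
    have "(\<lambda>n. g k - u k / real n) \<longlonglongrightarrow> g k"
      by real_asymp
    then have "\<forall>\<^sub>F n in sequentially. a < g k - u k / real n"
      using k by (rule order_tendstoD)
    then show "\<forall>\<^sub>F n in sequentially. a < 1 / real n * u n"
      using eventually_gt_at_top[of 0]
    proof eventually_elim
      case (elim n)
      with lower[of n k] show ?case by linarith
    qed
  next
    fix a assume "L < a"
    have "(\<lambda>n. L * real (n + r) / real n) \<longlonglongrightarrow> L"
      by real_asymp
    then have "\<forall>\<^sub>F n in sequentially. L * real (n + r) / real n < a"
      using \<open>L < a\<close> by (rule order_tendstoD)
    then show "\<forall>\<^sub>F n in sequentially. 1 / real n * u n < a"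
    proof eventually_elim
      case (elim n)
      have "u n / real n \<le> L * real (n + r) / real n"
        by (rule divide_right_mono[OF upper]) simp
      with elim show ?case by simp
    qed
  qed
  then show ?thesis
    by (rule convergentI)
qed

section \<open>Exponential sums determine their frequencies\<close>

text \<open>Among the vectors whose multiplicities differ, one of maximal norm \<open>x0\<close> has
  \<open>x0 \<bullet> x < x0 \<bullet> x0\<close> for every other \<open>x\<close>, so it dominates the sums at \<open>b = n x0\<close> as \<open>n \<rightarrow> \<infinity>\<close>.\<close>

lemma mset_eq_if_exp_sums_eq:
  fixes X Y :: "'a::real_inner list"
  assumes "\<And>b. (\<Sum>x\<leftarrow>X. exp (b \<bullet> x)) = (\<Sum>x\<leftarrow>Y. exp (b \<bullet> x))"
  shows "mset X = mset Y"
proof (rule ccontr)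
  define d where "d x = real (count (mset X) x) - real (count (mset Y) x)" for x
  define S where "S = {x \<in> set X \<union> set Y. d x \<noteq> 0}"
  assume "mset X \<noteq> mset Y"
  then obtain y where y: "count (mset X) y \<noteq> count (mset Y) y"
    by (auto simp: multiset_eq_iff)
  moreover from y have "y \<in> set X \<union> set Y"
    by (metis UnCI count_mset_0_iff)
  ultimately have "y \<in> S"
    by (simp add: S_def d_def)
  have fin: "finite S"
    by (simp add: S_def)
  define N where "N = Max (norm ` S)"
  have "N \<in> norm ` S"
    unfolding N_def using fin \<open>y \<in> S\<close> by (intro Max_in) auto
  then obtain x0 where x0: "x0 \<in> S" "norm x0 = N"
    by auto
  have x0_max: "norm x \<le> norm x0" if "x \<in> S" for x
    using that fin x0 by (simp add: N_def)
  have gap: "x0 \<bullet> x < x0 \<bullet> x0" if "x \<in> S" "x \<noteq> x0" for x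
  proof -
    have "0 < (x - x0) \<bullet> (x - x0)"
      using that by simp
    then have "2 * (x0 \<bullet> x) < x \<bullet> x + x0 \<bullet> x0"
      by (simp add: inner_diff_left inner_diff_right inner_commute)
    moreover have "x \<bullet> x \<le> x0 \<bullet> x0"
      using x0_max[OF that(1)] by (simp add: norm_le)
    ultimately show ?thesis by simp
  qed
  have sum_list_eq: "(\<Sum>x\<leftarrow>Z. f x) = (\<Sum>x\<in>set X \<union> set Y. real (count (mset Z) x) * f x)"
    if "set Z \<subseteq> set X \<union> set Y" for Z and f :: "'a \<Rightarrow> real"
    using that
  proof (induction Z)
    case (Cons z Z)
    have "(\<Sum>x\<in>set X \<union> set Y. real (count (mset (z # Z)) x) * f x)
        = (\<Sum>x\<in>set X \<union> set Y. real (count (mset Z) x) * f x + (if x = z then f x else 0))"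
      by (intro sum.cong) (auto simp: algebra_simps)
    also have "\<dots> = (\<Sum>x\<in>set X \<union> set Y. real (count (mset Z) x) * f x) + f z"
      using Cons.prems by (auto simp: sum.distrib sum.delta)
    finally show ?case
      using Cons by simp
  qed simp
  have zero: "(\<Sum>x\<in>S. d x * exp (b \<bullet> x)) = 0" for b
  proof -
    have "(\<Sum>x\<in>S. d x * exp (b \<bullet> x)) = (\<Sum>x\<in>set X \<union> set Y. d x * exp (b \<bullet> x))"
      by (rule sum.mono_neutral_left) (auto simp: S_def)
    also have "\<dots> = 0"
      using assms[of b] by (simp add: d_def left_diff_distrib sum_subtractf sum_list_eq)
    finally show ?thesis .
  qed
  have tend: "(\<lambda>n::nat. d x * exp (real n * (x0 \<bullet> x - x0 \<bullet> x0))) \<longlonglongrightarrow> (if x = x0 then d x0 else 0)"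
    if "x \<in> S" for x
  proof (cases "x = x0")
    case False
    define e where "e = x0 \<bullet> x0 - x0 \<bullet> x"
    have "e > 0"
      using gap[OF that False] by (simp add: e_def)
    then have "(\<lambda>n::nat. d x * exp (real n * (- e))) \<longlonglongrightarrow> 0"
      by real_asymp
    then show ?thesis
      using False by (simp add: e_def)
  qed simp
  have "(\<lambda>n::nat. \<Sum>x\<in>S. d x * exp (real n * (x0 \<bullet> x - x0 \<bullet> x0))) \<longlonglongrightarrow>
      (\<Sum>x\<in>S. if x = x0 then d x0 else 0)"
    by (intro tendsto_sum tend)
  moreover have "(\<Sum>x\<in>S. d x * exp (real n * (x0 \<bullet> x - x0 \<bullet> x0))) = 0" for n :: nat
  proof -
    have "(\<Sum>x\<in>S. d x * exp (real n * (x0 \<bullet> x - x0 \<bullet> x0)))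
        = (\<Sum>x\<in>S. d x * exp ((real n *\<^sub>R x0) \<bullet> x)) * exp (- (real n * (x0 \<bullet> x0)))"
      by (simp add: sum_distrib_right mult.assoc right_diff_distrib flip: exp_add)
    then show ?thesis
      by (simp only: zero mult_zero_left)
  qed
  ultimately have "d x0 = 0"
    using x0 fin by (simp add: LIMSEQ_const_iff sum.delta)
  then show False
    using x0 by (simp add: S_def)
qed

section \<open>Semigroup, group and interior of the cone\<close>

text \<open>Distinct integral vectors differ by at least 1 in some coordinate. This makes the
  semigroup closed, so that nearest points exist, and bounded parts of the group finite.\<close>

lemma uniform_discrete_integral:
  fixes S :: "(real ^ 'n) set"
  assumes "\<And>x i. x \<in> S \<Longrightarrow> x $ i \<in> \<int>"
  shows "uniform_discrete S"
  unfolding uniform_discrete_def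
proof (intro exI[of _ 1] conjI ballI impI)
  fix x y assume xy: "x \<in> S" "y \<in> S" "dist x y < 1"
  show "x = y"
  proof (rule vec_eq_iff[THEN iffD2, rule_format])
    fix i
    have "\<bar>x $ i - y $ i\<bar> < 1"
      using component_le_norm_cart[of "x - y" i] xy(3) by (simp add: dist_norm)
    moreover have "x $ i - y $ i \<in> \<int>"
      using assms xy by auto
    ultimately show "x $ i = y $ i"
      using Ints_nonzero_abs_less1 by force
  qed
qed simp

lemma family_semigroup_0: "0 \<in> family_semigroup X"
  unfolding family_semigroup_def by (auto intro!: exI[of _ "\<lambda>_. 0"])

lemma family_semigroup_add:
  assumes "x \<in> family_semigroup X" "y \<in> family_semigroup X"
  shows "x + y \<in> family_semigroup X"
proof -
  from assms obtain a b :: "nat \<Rightarrow> nat"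
    where "x = (\<Sum>j<length X. real (a j) *\<^sub>R X ! j)" "y = (\<Sum>j<length X. real (b j) *\<^sub>R X ! j)"
    by (auto simp: family_semigroup_def)
  then have "x + y = (\<Sum>j<length X. real (a j + b j) *\<^sub>R X ! j)"
    by (simp add: sum.distrib scaleR_add_left)
  then show ?thesis
    by (auto simp: family_semigroup_def intro!: exI[of _ "\<lambda>j. a j + b j"])
qed

lemma family_semigroup_scale:
  "x \<in> family_semigroup X \<Longrightarrow> real n *\<^sub>R x \<in> family_semigroup X"
  by (induction n) (auto simp: family_semigroup_0 scaleR_add_left intro: family_semigroup_add)

text \<open>The subgroup generated by \<open>X\<close>. Differences of nearest points are at first
  known to lie only here; \<open>group_near_interior\<close> brings them back into the
  semigroup.\<close>

definition family_group :: "(real ^ 'n) list \<Rightarrow> (real ^ 'n) set" where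
  "family_group X = {x - y | x y. x \<in> family_semigroup X \<and> y \<in> family_semigroup X}"

lemma family_semigroup_subset_group: "family_semigroup X \<subseteq> family_group X"
  unfolding family_group_def using family_semigroup_0 by (force intro: exI[of _ "0 :: real ^ 'n"])

lemma family_group_diff:
  assumes "x \<in> family_group X" "y \<in> family_group X"
  shows "x - y \<in> family_group X"
proof -
  from assms obtain a b c d where "x = a - b" "y = c - d"
    and in_sg: "a \<in> family_semigroup X" "b \<in> family_semigroup X"
      "c \<in> family_semigroup X" "d \<in> family_semigroup X"
    by (auto simp: family_group_def)
  then have "x - y = (a + d) - (b + c)"
    by simp
  with in_sg show ?thesis
    unfolding family_group_def using family_semigroup_add by blast
qed

text \<open>The relative interior of the cone, hence its interior when \<open>X\<close> spans.
  Positive coefficients are the form needed for rounding them down later.\<close>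

definition family_interior :: "(real ^ 'n) list \<Rightarrow> (real ^ 'n) set" where
  "family_interior X =
     {\<Sum>j<length X. c j *\<^sub>R X ! j | c :: nat \<Rightarrow> real. \<forall>j<length X. c j > 0}"

lemma family_interior_subset_cone: "family_interior X \<subseteq> family_cone X"
  unfolding family_interior_def family_cone_def by (auto intro: less_imp_le)

lemma family_interior_scale:
  assumes "x \<in> family_interior X" "t > 0"
  shows "t *\<^sub>R x \<in> family_interior X"
proof -
  from assms obtain c where "x = (\<Sum>j<length X. c j *\<^sub>R X ! j)" "\<forall>j<length X. c j > 0"
    by (auto simp: family_interior_def)
  with \<open>t > 0\<close> show ?thesis
    unfolding family_interior_def
    by (auto intro!: exI[of _ "\<lambda>j. t * c j"] simp: scaleR_sum_right)
qed

lemma family_cone_scale: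
  assumes "x \<in> family_cone X" "t \<ge> 0"
  shows "t *\<^sub>R x \<in> family_cone X"
proof -
  from assms obtain c where "x = (\<Sum>j<length X. c j *\<^sub>R X ! j)" "\<forall>j<length X. c j \<ge> 0"
    by (auto simp: family_cone_def)
  with \<open>t \<ge> 0\<close> show ?thesis
    unfolding family_cone_def
    by (auto intro!: exI[of _ "\<lambda>j. t * c j"] simp: scaleR_sum_right)
qed

lemma semigroup_add_sum_in_interior:
  assumes "z \<in> family_semigroup X"
  shows "z + (\<Sum>j<length X. X ! j) \<in> family_interior X"
proof -
  from assms obtain a :: "nat \<Rightarrow> nat" where "z = (\<Sum>j<length X. real (a j) *\<^sub>R X ! j)"
    by (auto simp: family_semigroup_def)
  then show ?thesis
    unfolding family_interior_def
    by (auto intro!: exI[of _ "\<lambda>j. real (a j) + 1"] simp: scaleR_add_left sum.distrib)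
qed

text \<open>Subtracting a small multiple \<open>e\<close> of the sum of \<open>Y\<close> from
  \<open>x\<close> keeps all coefficients over \<open>X\<close> positive, so the difference is still
  in the common cone. Writing it over \<open>Y\<close> and adding the multiple back makes every
  coefficient at least \<open>e\<close>.\<close>

lemma family_interior_subset_if_cone_eq:
  assumes "family_cone X = family_cone Y"
  shows "family_interior X \<subseteq> family_interior Y"
proof
  fix x assume "x \<in> family_interior X"
  then obtain c where c: "x = (\<Sum>j<length X. c j *\<^sub>R X ! j)" "\<And>j. j < length X \<Longrightarrow> c j > 0"
    by (auto simp: family_interior_def)
  have "(\<Sum>j<length Y. Y ! j) \<in> family_cone Y"
    unfolding family_cone_def by (auto intro!: exI[of _ "\<lambda>_. 1"])
  then obtain d where d: "(\<Sum>j<length Y. Y ! j) = (\<Sum>j<length X. d j *\<^sub>R X ! j)"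
    unfolding assms[symmetric] by (auto simp: family_cone_def)
  have "\<forall>\<^sub>F e in at_right (0::real). \<forall>j\<in>{..<length X}. 0 < c j - e * d j"
  proof (intro eventually_ball_finite ballI)
    fix j assume "j \<in> {..<length X}"
    moreover have "((\<lambda>e. c j - e * d j) \<longlongrightarrow> c j - 0 * d j) (at_right 0)"
      by (intro tendsto_intros)
    ultimately show "\<forall>\<^sub>F e in at_right 0. 0 < c j - e * d j"
      using c(2)[of j] by (intro order_tendstoD) auto
  qed simp
  then have "\<forall>\<^sub>F e in at_right (0::real). e > 0 \<and> (\<forall>j\<in>{..<length X}. 0 < c j - e * d j)"
    using eventually_at_right_less[of 0] by eventually_elim simp
  then have "\<exists>e::real. e > 0 \<and> (\<forall>j\<in>{..<length X}. 0 < c j - e * d j)"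
    by (rule eventually_happens'[OF trivial_limit_at_right_real])
  then obtain e where e: "e > 0" "\<And>j. j < length X \<Longrightarrow> 0 < c j - e * d j"
    by auto
  have "x - e *\<^sub>R (\<Sum>j<length Y. Y ! j) = (\<Sum>j<length X. (c j - e * d j) *\<^sub>R X ! j)"
    by (simp add: c(1) d scaleR_diff_left sum_subtractf scaleR_sum_right)
  then have "x - e *\<^sub>R (\<Sum>j<length Y. Y ! j) \<in> family_cone X"
    using e(2) unfolding family_cone_def by (auto intro!: exI[of _ "\<lambda>j. c j - e * d j"] less_imp_le)
  then obtain f where f: "x - e *\<^sub>R (\<Sum>j<length Y. Y ! j) = (\<Sum>j<length Y. f j *\<^sub>R Y ! j)"
    "\<And>j. j < length Y \<Longrightarrow> f j \<ge> 0"
    unfolding assms by (auto simp: family_cone_def)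
  have "x = (\<Sum>j<length Y. (f j + e) *\<^sub>R Y ! j)"
    using f(1) by (simp add: scaleR_add_left sum.distrib scaleR_sum_right diff_eq_eq)
  then show "x \<in> family_interior Y"
    unfolding family_interior_def using f(2) e(1) by (auto intro!: exI[of _ "\<lambda>j. f j + e"] add_nonneg_pos)
qed

section \<open>Words, multiplicities and the exponential sum\<close>

text \<open>Coplanarity makes \<open>\<eta> \<bullet> z\<close> the common length of all words with
  sum \<open>z\<close>. Nonemptiness keeps \<open>Z\<close> positive, so that its logarithm is
  meaningful.\<close>

locale coplanar_family =
  fixes X :: "(real ^ 'n) list" and \<eta> :: "real ^ 'n"
  assumes integral: "\<And>x i. x \<in> set X \<Longrightarrow> x $ i \<in> \<int>"
    and coplanar: "\<And>x. x \<in> set X \<Longrightarrow> \<eta> \<bullet> x = 1"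
    and nonempty: "X \<noteq> []"
begin

definition words :: "nat \<Rightarrow> nat list set" where
  "words n = {w. set w \<subseteq> {..<length X} \<and> length w = n}"

definition wsum :: "nat list \<Rightarrow> real ^ 'n" where
  "wsum w = sum_list (map (\<lambda>i. X ! i) w)"

definition Z :: "real ^ 'n \<Rightarrow> real" where
  "Z b = (\<Sum>x\<leftarrow>X. exp (b \<bullet> x))"

lemma Z_pos: "Z b > 0"
  unfolding Z_def using nonempty by (cases X) (auto intro!: add_pos_nonneg sum_list_nonneg)

lemma Z_eq_sum: "Z b = (\<Sum>j<length X. exp (b \<bullet> X ! j))"
  by (simp add: Z_def sum_list_sum_nth atLeast0LessThan)

lemma finite_words: "finite (words n)"
  unfolding words_def by (rule finite_lists_length_eq) simp

lemma wsum_append: "wsum (v @ w) = wsum v + wsum w"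
  by (simp add: wsum_def)

lemma eta_wsum: "set w \<subseteq> {..<length X} \<Longrightarrow> \<eta> \<bullet> wsum w = real (length w)"
  by (induction w) (auto simp: wsum_def inner_add_right coplanar)

lemma wsum_eq_sum_count:
  "set w \<subseteq> {..<length X} \<Longrightarrow> wsum w = (\<Sum>j<length X. real (count_list w j) *\<^sub>R X ! j)"
proof (induction w)
  case (Cons i w)
  have "(\<Sum>j<length X. real (count_list (i # w) j) *\<^sub>R X ! j)
      = (\<Sum>j<length X. real (count_list w j) *\<^sub>R X ! j + (if j = i then X ! j else 0))"
    by (intro sum.cong) (auto simp: scaleR_add_left)
  also have "\<dots> = wsum w + X ! i"
    using Cons by (simp add: sum.distrib sum.delta)
  finally show ?case
    by (simp add: wsum_def)
qed (simp add: wsum_def)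

lemma wsum_in_semigroup: "set w \<subseteq> {..<length X} \<Longrightarrow> wsum w \<in> family_semigroup X"
  using wsum_eq_sum_count[of w] unfolding family_semigroup_def by blast

lemma semigroup_obtain_word:
  assumes "z \<in> family_semigroup X"
  obtains w where "set w \<subseteq> {..<length X}" "wsum w = z"
proof -
  from assms obtain a :: "nat \<Rightarrow> nat" where a: "z = (\<Sum>j<length X. real (a j) *\<^sub>R X ! j)"
    by (auto simp: family_semigroup_def)
  define w where "w m = concat (map (\<lambda>j. replicate (a j) j) [0..<m])" for m
  have "wsum (w m) = (\<Sum>j<m. real (a j) *\<^sub>R X ! j)" for m
    by (induction m) (simp_all add: w_def wsum_def sum_list_replicate scaleR_conv_of_real sum_list_triv)
  moreover have "set (w (length X)) \<subseteq> {..<length X}"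
    by (auto simp: w_def)
  ultimately show thesis
    using a that by blast
qed

lemma word_mult_eq: "word_mult X z = card {w. set w \<subseteq> {..<length X} \<and> wsum w = z}"
  by (simp add: word_mult_def wsum_def)

lemma finite_words_of: "finite {w. set w \<subseteq> {..<length X} \<and> wsum w = z}"
proof (rule finite_subset[OF _ finite_words])
  \<comment> \<open>The length is forced to be \<open>\<eta> \<bullet> z\<close>; the floor only
    converts this real number to a natural one.\<close>
  show "{w. set w \<subseteq> {..<length X} \<and> wsum w = z} \<subseteq> words (nat \<lfloor>\<eta> \<bullet> z\<rfloor>)"
    by (auto simp: words_def eta_wsum)
qed

lemma word_mult_pos: "z \<in> family_semigroup X \<Longrightarrow> word_mult X z \<ge> 1"
  unfolding word_mult_eq
  by (metis (mono_tags, lifting) One_nat_def Suc_leI card_gt_0_iff empty_iff finite_words_of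
      mem_Collect_eq semigroup_obtain_word)

text \<open>Concatenation of words is injective here, because the first factor has the prescribed
  length \<open>\<eta> \<bullet> y\<close> and so the cut can be recovered.\<close>

lemma word_mult_super: "word_mult X y * word_mult X z \<le> word_mult X (y + z)"
proof -
  let ?W = "\<lambda>z. {w. set w \<subseteq> {..<length X} \<and> wsum w = z}"
  have "inj_on (\<lambda>(v, w). v @ w) (?W y \<times> ?W z)"
  proof (rule inj_onI, clarsimp)
    fix v w v' w'
    assume "v @ w = v' @ w'" "set v \<subseteq> {..<length X}" "set v' \<subseteq> {..<length X}"
      "wsum v' = wsum v"
    moreover from this have "length v = length v'"
      using eta_wsum[of v] eta_wsum[of v'] by simp
    ultimately show "v = v' \<and> w = w'"
      by simp
  qed
  then have "card (?W y \<times> ?W z) = card ((\<lambda>(v, w). v @ w) ` (?W y \<times> ?W z))"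
    by (simp add: card_image)
  also have "\<dots> \<le> card (?W (y + z))"
    by (rule card_mono[OF finite_words_of]) (auto simp: wsum_append)
  finally show ?thesis
    by (simp add: word_mult_eq card_cartesian_product)
qed

lemma word_mult_power: "word_mult X z ^ q \<le> word_mult X (real q *\<^sub>R z)"
proof (induction q)
  case 0
  show ?case
    using word_mult_pos[OF family_semigroup_0] by simp
next
  case (Suc q)
  have "word_mult X z ^ Suc q \<le> word_mult X z * word_mult X (real q *\<^sub>R z)"
    using Suc by simp
  also have "\<dots> \<le> word_mult X (z + real q *\<^sub>R z)"
    by (rule word_mult_super)
  finally show ?case
    by (simp add: scaleR_add_left add.commute)
qed

lemma sum_exp_words: "(\<Sum>w\<in>words n. exp (b \<bullet> wsum w)) = Z b ^ n"
proof (induction n)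
  case 0
  have "words 0 = {[]}"
    by (auto simp: words_def)
  then show ?case
    by (simp add: wsum_def)
next
  case (Suc n)
  have "words (Suc n) = (\<lambda>(i, w). i # w) ` ({..<length X} \<times> words n)"
    by (auto simp: words_def image_iff length_Suc_conv)
  then have "(\<Sum>w\<in>words (Suc n). exp (b \<bullet> wsum w))
      = (\<Sum>(i, w)\<in>{..<length X} \<times> words n. exp (b \<bullet> X ! i) * exp (b \<bullet> wsum w))"
    by (simp add: sum.reindex inj_on_def case_prod_unfold wsum_def inner_add_right exp_add)
  also have "\<dots> = Z b * Z b ^ n"
    unfolding Suc[symmetric]
    unfolding Z_eq_sum by (simp add: sum_product sum.cartesian_product)
  finally show ?case
    by simp
qed

text \<open>Words of length \<open>n\<close> are grouped by their sum \<open>z\<close>. Each group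
  contains all words with sum \<open>z\<close>, since they all have the same length, and therefore
  has \<open>word_mult X z\<close> elements.\<close>

lemma sum_exp_words_grouped:
  "(\<Sum>z\<in>wsum ` words n. real (word_mult X z) * exp (b \<bullet> z)) = Z b ^ n"
proof -
  have "Z b ^ n = (\<Sum>z\<in>wsum ` words n. \<Sum>w\<in>{w \<in> words n. wsum w = z}. exp (b \<bullet> wsum w))"
    unfolding sum_exp_words[symmetric]
    by (rule sum.group[symmetric]) (auto simp: finite_words)
  also have "\<dots> = (\<Sum>z\<in>wsum ` words n. real (word_mult X z) * exp (b \<bullet> z))"
  proof (rule sum.cong[OF refl])
    fix z assume "z \<in> wsum ` words n"
    then have "\<eta> \<bullet> z = real n"
      by (auto simp: words_def eta_wsum)
    then have "{w \<in> words n. wsum w = z} = {w. set w \<subseteq> {..<length X} \<and> wsum w = z}"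
      using eta_wsum by (auto simp: words_def)
    then show "(\<Sum>w\<in>{w \<in> words n. wsum w = z}. exp (b \<bullet> wsum w)) = real (word_mult X z) * exp (b \<bullet> z)"
      by (simp add: word_mult_eq)
  qed
  finally show ?thesis by simp
qed

text \<open>A single term of the grouped sum, all of whose terms are nonnegative, is at most
  \<open>Z b ^ n\<close> with \<open>n = \<eta> \<bullet> z\<close>.\<close>

lemma ln_word_mult_le:
  assumes "z \<in> family_semigroup X"
  shows "ln (real (word_mult X z)) \<le> (\<eta> \<bullet> z) * ln (Z b) - b \<bullet> z"
proof -
  obtain w where w: "set w \<subseteq> {..<length X}" "wsum w = z"
    using semigroup_obtain_word[OF assms] .
  define n where "n = length w"
  have n: "\<eta> \<bullet> z = real n"
    using eta_wsum[OF w(1)] w(2) by (simp add: n_def)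
  have "real (word_mult X z) * exp (b \<bullet> z) \<le> Z b ^ n"
    unfolding sum_exp_words_grouped[symmetric]
    by (rule member_le_sum) (use w in \<open>auto simp: n_def words_def finite_words[unfolded words_def]\<close>)
  then have "ln (real (word_mult X z) * exp (b \<bullet> z)) \<le> ln (Z b ^ n)"
    using word_mult_pos[OF assms] by (intro ln_mono) auto
  then show ?thesis
    using word_mult_pos[OF assms] Z_pos[of b] by (simp add: ln_mult ln_realpow n)
qed

text \<open>The sum of a word depends only on how often each letter occurs, and each of these counts
  is at most \<open>n\<close>.\<close>

lemma card_wsum_words_le: "card (wsum ` words n) \<le> (n + 1) ^ length X"
proof -
  have "wsum ` words n \<subseteq>
      (\<lambda>a. \<Sum>j<length X. real (a j) *\<^sub>R X ! j) ` ({..<length X} \<rightarrow>\<^sub>E {..n})"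
  proof clarify
    fix w assume "w \<in> words n"
    then have w: "set w \<subseteq> {..<length X}" "length w = n"
      by (auto simp: words_def)
    show "wsum w \<in> (\<lambda>a. \<Sum>j<length X. real (a j) *\<^sub>R X ! j) ` ({..<length X} \<rightarrow>\<^sub>E {..n})"
    proof (rule image_eqI)
      show "wsum w = (\<Sum>j<length X. real (restrict (count_list w) {..<length X} j) *\<^sub>R X ! j)"
        using wsum_eq_sum_count[OF w(1)] by simp
      show "restrict (count_list w) {..<length X} \<in> {..<length X} \<rightarrow>\<^sub>E {..n}"
        using count_le_length[of w] w(2) by auto
    qed
  qed
  then have "card (wsum ` words n) \<le> card ({..<length X} \<rightarrow>\<^sub>E {..n})"
    by (meson surj_card_le finite_PiE finite_lessThan finite_atMost)
  then show ?thesis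
    by (simp add: card_PiE)
qed

text \<open>Pigeonhole: \<open>Z b ^ n\<close> is a sum of at most \<open>(n + 1) ^ length X\<close>
  terms, so some term reaches that fraction of it. This is the converse of
  \<open>ln_word_mult_le\<close> up to a logarithmic error.\<close>

lemma exists_large_word_mult:
  obtains z where "z \<in> family_semigroup X" "\<eta> \<bullet> z = real n"
    "real n * ln (Z b) \<le> ln (real (word_mult X z)) + b \<bullet> z + real (length X) * ln (real n + 1)"
proof -
  let ?f = "\<lambda>z. real (word_mult X z) * exp (b \<bullet> z)"
  have "\<exists>z\<in>wsum ` words n. Z b ^ n \<le> real ((n + 1) ^ length X) * ?f z"
  proof (rule ccontr)
    assume "\<not> ?thesis"
    then have less: "?f z < Z b ^ n / real ((n + 1) ^ length X)" if "z \<in> wsum ` words n" for z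
      using that by (fastforce simp: field_simps not_le)
    \<comment> \<open>The index set must be nonempty for the sums to compare strictly.\<close>
    have "replicate n 0 \<in> words n"
      using nonempty by (auto simp: words_def)
    then have "(\<Sum>z\<in>wsum ` words n. ?f z) < (\<Sum>z\<in>wsum ` words n. Z b ^ n / real ((n + 1) ^ length X))"
      by (intro sum_strict_mono less) (auto simp: finite_words)
    also have "\<dots> = real (card (wsum ` words n)) * (Z b ^ n / real ((n + 1) ^ length X))"
      by simp
    also have "\<dots> \<le> real ((n + 1) ^ length X) * (Z b ^ n / real ((n + 1) ^ length X))"
      using card_wsum_words_le[of n] Z_pos[of b]
      by (intro mult_right_mono) (auto simp del: of_nat_power simp: less_imp_le)
    also have "\<dots> = Z b ^ n"
      by simp
    finally show False
      by (simp add: sum_exp_words_grouped)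
  qed
  then obtain w where w: "w \<in> words n" "Z b ^ n \<le> real ((n + 1) ^ length X) * ?f (wsum w)"
    by auto
  have mem: "wsum w \<in> family_semigroup X"
    using w(1) by (simp add: words_def wsum_in_semigroup)
  have "ln (Z b ^ n) \<le> ln (real ((n + 1) ^ length X) * ?f (wsum w))"
    using w(2) Z_pos[of b] by (intro ln_mono) auto
  also have "\<dots> = real (length X) * ln (real n + 1) + ln (real (word_mult X (wsum w))) + b \<bullet> wsum w"
    using word_mult_pos[OF mem] by (simp add: ln_mult ln_realpow add.commute)
  finally show thesis
    using that[OF mem] w(1) Z_pos[of b] by (simp add: ln_realpow words_def eta_wsum)
qed

section \<open>Rounding and nearest points\<close>

text \<open>A uniform bound for the distance from a point of the cone to the semigroup: rounding
  down all coefficients moves the point by at most this much.\<close>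

definition total_norm :: real where "total_norm = (\<Sum>j<length X. norm (X ! j))"

lemma group_integral:
  assumes "z \<in> family_group X" shows "z $ i \<in> \<int>"
proof -
  have "x $ i \<in> \<int>" if "x \<in> family_semigroup X" for x
    using that by (auto simp: family_semigroup_def sum_component intro!: Ints_sum Ints_mult integral[OF nth_mem])
  with assms show ?thesis
    by (auto simp: family_group_def)
qed

lemma finite_group_cball: "finite {v \<in> family_group X. norm v \<le> R}"
  unfolding uniform_discrete_finite_iff[symmetric]
  by (auto intro!: uniform_discrete_integral group_integral simp: bounded_iff)

lemma closed_semigroup: "closed (family_semigroup X)"
  using group_integral family_semigroup_subset_group
  by (blast intro: uniform_discrete_imp_closed uniform_discrete_integral)

lemma norm_diff_floor_le:
  assumes "\<And>j. j < length X \<Longrightarrow> 0 \<le> c j"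
  shows "norm ((\<Sum>j<length X. c j *\<^sub>R X ! j) - (\<Sum>j<length X. real (nat \<lfloor>c j\<rfloor>) *\<^sub>R X ! j)) \<le> total_norm"
proof -
  have "norm ((\<Sum>j<length X. c j *\<^sub>R X ! j) - (\<Sum>j<length X. real (nat \<lfloor>c j\<rfloor>) *\<^sub>R X ! j))
      = norm (\<Sum>j<length X. (c j - real (nat \<lfloor>c j\<rfloor>)) *\<^sub>R X ! j)"
    by (simp add: scaleR_diff_left sum_subtractf)
  also have "\<dots> \<le> (\<Sum>j<length X. norm ((c j - real (nat \<lfloor>c j\<rfloor>)) *\<^sub>R X ! j))"
    by (rule norm_sum)
  also have "\<dots> \<le> total_norm"
    unfolding total_norm_def
  proof (rule sum_mono)
    fix j assume "j \<in> {..<length X}"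
    then have "\<bar>c j - real (nat \<lfloor>c j\<rfloor>)\<bar> \<le> 1"
      using assms[of j] by (simp add: abs_le_iff) linarith
    then have "\<bar>c j - real (nat \<lfloor>c j\<rfloor>)\<bar> * norm (X ! j) \<le> 1 * norm (X ! j)"
      by (rule mult_right_mono) simp
    then show "norm ((c j - real (nat \<lfloor>c j\<rfloor>)) *\<^sub>R X ! j) \<le> norm (X ! j)"
      by simp
  qed
  finally show ?thesis .
qed

text \<open>All that is used later about \<open>cone_mult\<close>: its value is attained at some
  semigroup element within bounded distance. Which nearest point is chosen no longer
  matters.\<close>

lemma cone_mult_obtain:
  assumes "x \<in> family_cone X"
  obtains z where "z \<in> family_semigroup X" "norm (x - z) \<le> total_norm" "cone_mult X x = word_mult X z"
proof -
  let ?J = "family_semigroup X"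
  from assms obtain c where c: "x = (\<Sum>j<length X. c j *\<^sub>R X ! j)" "\<And>j. j < length X \<Longrightarrow> 0 \<le> c j"
    by (auto simp: family_cone_def)
  let ?w = "\<Sum>j<length X. real (nat \<lfloor>c j\<rfloor>) *\<^sub>R X ! j"
  have "?w \<in> ?J"
    by (auto simp: family_semigroup_def)
  then have "infdist x ?J \<le> dist x ?w"
    by (rule infdist_le)
  also have "\<dots> \<le> total_norm"
    using norm_diff_floor_le[of c] c by (simp add: dist_norm)
  finally have infdist_le: "infdist x ?J \<le> total_norm" .
  let ?M = "{word_mult X z | z. z \<in> ?J \<and> norm (x - z) = infdist x ?J}"
  have "?J \<noteq> {}"
    using family_semigroup_0 by blast
  \<comment> \<open>Since the semigroup is closed, a nearest point exists and \<open>?M\<close> is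
    nonempty; its infimum is then one of its members.\<close>
  then obtain y where "y \<in> ?J" "infdist x ?J = dist x y"
    using infdist_attains_inf[OF closed_semigroup, of x] by blast
  then have "word_mult X y \<in> ?M"
    by (auto simp: dist_norm)
  then have "Inf ?M \<in> ?M"
    by (intro Inf_nat_def1) blast
  then obtain z where "Inf ?M = word_mult X z" "z \<in> ?J" "norm (x - z) = infdist x ?J"
    by auto
  then show thesis
    using that infdist_le by (auto simp: cone_mult_def)
qed

text \<open>The bound of \<open>ln_word_mult_le\<close> is linear in \<open>z\<close>, so replacing
  the nearest point by \<open>k \<theta>\<close> costs an error independent of
  \<open>k\<close>.\<close>

lemma ln_cone_mult_le:
  assumes "\<theta> \<in> family_cone X"
  shows "ln (real (cone_mult X (real k *\<^sub>R \<theta>)))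
    \<le> ((\<eta> \<bullet> \<theta>) * ln (Z b) - b \<bullet> \<theta>) * real k + norm (ln (Z b) *\<^sub>R \<eta> - b) * total_norm"
proof -
  let ?c = "ln (Z b) *\<^sub>R \<eta> - b"
  obtain z where z: "z \<in> family_semigroup X" "norm (real k *\<^sub>R \<theta> - z) \<le> total_norm"
    "cone_mult X (real k *\<^sub>R \<theta>) = word_mult X z"
    using cone_mult_obtain[OF family_cone_scale[OF assms, of "real k"]] by auto
  have "ln (real (word_mult X z)) \<le> ?c \<bullet> z"
    using ln_word_mult_le[OF z(1), of b] by (simp add: inner_diff_left mult.commute)
  also have "\<dots> = ?c \<bullet> (real k *\<^sub>R \<theta>) + ?c \<bullet> (z - real k *\<^sub>R \<theta>)"
    by (simp add: inner_diff_right)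
  also have "?c \<bullet> (z - real k *\<^sub>R \<theta>) \<le> norm ?c * norm (z - real k *\<^sub>R \<theta>)"
    by (rule norm_cauchy_schwarz)
  also have "\<dots> \<le> norm ?c * total_norm"
    using z(2) by (intro mult_left_mono) (simp_all add: norm_minus_commute)
  finally show ?thesis
    by (simp add: z(3) inner_diff_left algebra_simps)
qed

text \<open>A group element near \<open>t \<theta>\<close> differs from the coefficientwise floor of \<open>t \<theta>\<close> by one of finitely
  many integral vectors, and the large coefficients of the floor absorb the negative ones.\<close>

lemma group_near_interior:
  assumes "\<theta> \<in> family_interior X"
  obtains t0 where "\<And>t v. t \<ge> t0 \<Longrightarrow> v \<in> family_group X \<Longrightarrow> norm (v - t *\<^sub>R \<theta>) \<le> R
    \<Longrightarrow> v \<in> family_semigroup X"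
proof -
  let ?S = "\<Sum>j<length X. X ! j"
  from assms obtain c where c: "\<theta> = (\<Sum>j<length X. c j *\<^sub>R X ! j)" "\<And>j. j < length X \<Longrightarrow> c j > 0"
    by (auto simp: family_interior_def)
  have "\<exists>N. \<forall>n\<ge>N. u + real n *\<^sub>R ?S \<in> family_semigroup X" if "u \<in> family_group X" for u
  proof -
    from that obtain x y where xy: "u = x - y" "x \<in> family_semigroup X" "y \<in> family_semigroup X"
      by (auto simp: family_group_def)
    then obtain a :: "nat \<Rightarrow> nat" where a: "y = (\<Sum>j<length X. real (a j) *\<^sub>R X ! j)"
      by (auto simp: family_semigroup_def)
    show ?thesis
    proof (intro exI allI impI)
      \<comment> \<open>Every coefficient \<open>a j\<close> of \<open>y\<close> is at most this
        sum, so \<open>n\<close> copies of \<open>?S\<close> absorb the subtraction of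
        \<open>y\<close>.\<close>
      fix n assume n: "n \<ge> (\<Sum>j<length X. a j)"
      have le: "a j \<le> n" if "j < length X" for j
        using member_le_sum[of j "{..<length X}" a] that n by simp
      have "real n *\<^sub>R ?S - y = (\<Sum>j<length X. real (n - a j) *\<^sub>R X ! j)"
        unfolding a scaleR_sum_right sum_subtractf[symmetric]
        by (intro sum.cong) (auto simp: le of_nat_diff scaleR_diff_left)
      then have "real n *\<^sub>R ?S - y \<in> family_semigroup X"
        unfolding family_semigroup_def by (auto intro!: exI[of _ "\<lambda>j. n - a j"])
      from family_semigroup_add[OF xy(2) this] show "u + real n *\<^sub>R ?S \<in> family_semigroup X"
        by (simp add: xy(1) algebra_simps)
    qed
  qed
  then obtain N where N: "\<And>u n. u \<in> family_group X \<Longrightarrow> n \<ge> N u \<Longrightarrow> u + real n *\<^sub>R ?S \<in> family_semigroup X"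
    by metis
  define V where "V = {v \<in> family_group X. norm v \<le> R + total_norm}"
  \<comment> \<open>\<open>V\<close> is finite because the group is discrete, so one
    \<open>n\<close> serves all its elements.\<close>
  define n where "n = (\<Sum>v\<in>V. N v)"
  have n: "u + real n *\<^sub>R ?S \<in> family_semigroup X" if "u \<in> V" for u
    using that member_le_sum[of u V N] finite_group_cball[of "R + total_norm"]
    by (intro N) (auto simp: n_def V_def)
  \<comment> \<open>All summands are positive, so \<open>t0\<close> dominates each of them, and
    beyond \<open>t0\<close> every rounded coefficient of \<open>t \<theta>\<close> is at least
    \<open>n\<close>.\<close>
  define t0 where "t0 = (\<Sum>j<length X. (real n + 1) / c j)"
  show thesis
  proof (rule that[of t0])
    fix t v assume t: "t \<ge> t0" and v: "v \<in> family_group X" "norm (v - t *\<^sub>R \<theta>) \<le> R"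
    have large: "real n + 1 \<le> t * c j" if "j < length X" for j
    proof -
      have "(real n + 1) / c j \<le> t0"
        unfolding t0_def using c(2) that
        by (intro member_le_sum[where f = "\<lambda>j. (real n + 1) / c j"]) (auto intro: divide_nonneg_pos)
      with t have "(real n + 1) / c j \<le> t"
        by simp
      then show ?thesis
        using c(2)[OF that] by (simp add: pos_divide_le_eq)
    qed
    define a where "a j = nat \<lfloor>t * c j\<rfloor>" for j
    define w where "w = (\<Sum>j<length X. real (a j) *\<^sub>R X ! j)"
    have "w \<in> family_semigroup X"
      by (auto simp: w_def family_semigroup_def)
    have le: "n \<le> a j" if "j < length X" for j
      using large[OF that] by (simp add: a_def le_nat_iff le_floor_iff)
    have "w - real n *\<^sub>R ?S = (\<Sum>j<length X. real (a j - n) *\<^sub>R X ! j)"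
      unfolding w_def scaleR_sum_right sum_subtractf[symmetric]
      by (intro sum.cong) (auto simp: le of_nat_diff scaleR_diff_left)
    then have rest: "w - real n *\<^sub>R ?S \<in> family_semigroup X"
      unfolding family_semigroup_def by (auto intro!: exI[of _ "\<lambda>j. a j - n"])
    have "0 \<le> t * c j" if "j < length X" for j
      using large[OF that] by linarith
    from norm_diff_floor_le[of "\<lambda>j. t * c j", OF this] have "norm (t *\<^sub>R \<theta> - w) \<le> total_norm"
      by (simp add: w_def a_def c(1) scaleR_sum_right)
    then have "norm (v - w) \<le> R + total_norm"
      using v(2) norm_triangle_ineq[of "v - t *\<^sub>R \<theta>" "t *\<^sub>R \<theta> - w"] by simp
    moreover have "v - w \<in> family_group X"
      using v(1) \<open>w \<in> family_semigroup X\<close> family_semigroup_subset_group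
      by (blast intro: family_group_diff)
    ultimately have "v - w \<in> V"
      by (simp add: V_def)
    from family_semigroup_add[OF rest n[OF this]] show "v \<in> family_semigroup X"
      by simp
  qed
qed

section \<open>The growth limit in interior directions\<close>

text \<open>Nearest points \<open>z k\<close> need not be additive, but
  \<open>z (k + l + r) - z k - z l\<close> stays within \<open>3 * total_norm\<close> of
  \<open>r \<theta>\<close>. For a fixed large \<open>r\<close> it therefore lies in the semigroup,
  and supermultiplicativity gives the hypothesis of \<open>fekete_shifted\<close>.\<close>

lemma dir_growth_tendsto:
  assumes "\<theta> \<in> family_interior X"
  shows "(\<lambda>k. 1 / real k * ln (real (cone_mult X (real k *\<^sub>R \<theta>)))) \<longlonglongrightarrow> dir_growth X \<theta>"
proof -
  have cone: "\<theta> \<in> family_cone X"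
    using assms family_interior_subset_cone by blast
  have "\<exists>z. z \<in> family_semigroup X \<and> norm (real k *\<^sub>R \<theta> - z) \<le> total_norm \<and>
      cone_mult X (real k *\<^sub>R \<theta>) = word_mult X z" for k
    using cone_mult_obtain[OF family_cone_scale[OF cone, of "real k"]] by auto
  then obtain z where z: "\<And>k. z k \<in> family_semigroup X" "\<And>k. norm (real k *\<^sub>R \<theta> - z k) \<le> total_norm"
    "\<And>k. cone_mult X (real k *\<^sub>R \<theta>) = word_mult X (z k)"
    by metis
  obtain t0 where t0: "\<And>t v. t \<ge> t0 \<Longrightarrow> v \<in> family_group X \<Longrightarrow> norm (v - t *\<^sub>R \<theta>) \<le> 3 * total_norm
    \<Longrightarrow> v \<in> family_semigroup X"
    using group_near_interior[OF assms] by blast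
  define r where "r = nat \<lceil>max 1 t0\<rceil>"
  have r: "r > 0" "real r \<ge> t0"
    by (auto simp: r_def) linarith
  have "convergent (\<lambda>k. 1 / real k * ln (real (cone_mult X (real k *\<^sub>R \<theta>))))"
  proof (rule fekete_shifted[OF _ \<open>r > 0\<close>])
    fix k l
    define v where "v = z (k + l + r) - z k - z l"
    have "v - real r *\<^sub>R \<theta> = - (real (k + l + r) *\<^sub>R \<theta> - z (k + l + r))
        + ((real k *\<^sub>R \<theta> - z k) + (real l *\<^sub>R \<theta> - z l))"
      by (simp add: v_def algebra_simps)
    also have "norm \<dots> \<le> norm (real (k + l + r) *\<^sub>R \<theta> - z (k + l + r))
        + (norm (real k *\<^sub>R \<theta> - z k) + norm (real l *\<^sub>R \<theta> - z l))"
      by (metis (no_types) add_left_mono norm_minus_cancel norm_triangle_ineq norm_triangle_le)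
    also have "\<dots> \<le> 3 * total_norm"
      using z(2)[of "k + l + r"] z(2)[of k] z(2)[of l] by linarith
    finally have "v \<in> family_semigroup X"
      using z(1) family_semigroup_subset_group r(2)
      by (intro t0[of "real r"]) (auto simp: v_def intro!: family_group_diff)
    then have "1 \<le> word_mult X v"
      by (rule word_mult_pos)
    then have "word_mult X (z k) * word_mult X (z l) \<le> (word_mult X (z k) * word_mult X (z l)) * word_mult X v"
      by simp
    also have "\<dots> \<le> word_mult X (z k + z l) * word_mult X v"
      by (intro mult_right_mono word_mult_super) simp
    also have "\<dots> \<le> word_mult X (z k + z l + v)"
      by (rule word_mult_super)
    finally have "word_mult X (z k) * word_mult X (z l) \<le> word_mult X (z (k + l + r))"
      by (simp add: v_def)
    then have "real (word_mult X (z k)) * real (word_mult X (z l)) \<le> real (word_mult X (z (k + l + r)))"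
      by (simp flip: of_nat_mult)
    moreover have "0 < word_mult X (z k)" "0 < word_mult X (z l)"
      using word_mult_pos[OF z(1)] by (auto simp: Suc_le_eq)
    ultimately have "ln (real (word_mult X (z k)) * real (word_mult X (z l)))
        \<le> ln (real (word_mult X (z (k + l + r))))"
      by (intro ln_mono) auto
    with \<open>0 < word_mult X (z k)\<close> \<open>0 < word_mult X (z l)\<close>
    have "ln (real (word_mult X (z k))) + ln (real (word_mult X (z l)))
        \<le> ln (real (word_mult X (z (k + l + r))))"
      by (simp add: ln_mult)
    then show "ln (real (cone_mult X (real k *\<^sub>R \<theta>))) + ln (real (cone_mult X (real l *\<^sub>R \<theta>)))
        \<le> ln (real (cone_mult X (real (k + l + r) *\<^sub>R \<theta>)))"
      by (simp only: z(3))
  next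
    fix k
    show "0 \<le> ln (real (cone_mult X (real k *\<^sub>R \<theta>)))"
      using word_mult_pos[OF z(1)[of k]] by (simp add: z(3))
    \<comment> \<open>Any \<open>b\<close> yields a linear bound; \<open>b = 0\<close> is
      taken.\<close>
    show "ln (real (cone_mult X (real k *\<^sub>R \<theta>)))
      \<le> ((\<eta> \<bullet> \<theta>) * ln (Z 0) - 0 \<bullet> \<theta>) * real k + norm (ln (Z 0) *\<^sub>R \<eta> - 0) * total_norm"
      by (rule ln_cone_mult_le[OF cone])
  qed
  then show ?thesis
    unfolding dir_growth_def by (simp add: convergent_LIMSEQ_iff)
qed

lemma dir_growth_le:
  assumes "\<theta> \<in> family_interior X"
  shows "dir_growth X \<theta> \<le> (\<eta> \<bullet> \<theta>) * ln (Z b) - b \<bullet> \<theta>"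
proof -
  define A where "A = (\<eta> \<bullet> \<theta>) * ln (Z b) - b \<bullet> \<theta>"
  define B where "B = norm (ln (Z b) *\<^sub>R \<eta> - b) * total_norm"
  have cone: "\<theta> \<in> family_cone X"
    using assms family_interior_subset_cone by blast
  have "(\<lambda>k. 1 / real k * (A * real k + B)) \<longlonglongrightarrow> A"
    by real_asymp
  with dir_growth_tendsto[OF assms] have "dir_growth X \<theta> \<le> A"
    by (rule LIMSEQ_le)
      (auto intro!: mult_left_mono ln_cone_mult_le[OF cone] simp: A_def B_def simp del: times_divide_eq_left)
  then show ?thesis
    by (simp add: A_def)
qed

text \<open>With \<open>s = norm z\<close>, about \<open>k / s\<close> copies of \<open>z\<close>
  fit below the nearest point of \<open>k z / s\<close>. The remainder lies in the semigroup, so the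
  multiplicity there is at least \<open>word_mult X z\<close> to that power.\<close>

lemma dir_growth_ge:
  assumes "z \<in> family_semigroup X" "z \<in> family_interior X" "z \<noteq> 0"
  shows "ln (real (word_mult X z)) \<le> norm z * dir_growth X (z /\<^sub>R norm z)"
proof -
  let ?\<theta> = "z /\<^sub>R norm z"
  define s where "s = norm z"
  have s: "s > 0"
    using assms(3) by (simp add: s_def)
  have interior: "?\<theta> \<in> family_interior X"
    using assms(2,3) by (intro family_interior_scale) auto
  then have cone: "?\<theta> \<in> family_cone X"
    using family_interior_subset_cone by blast
  define M where "M = ln (real (word_mult X z))"
  have "M \<ge> 0"
    using word_mult_pos[OF assms(1)] by (simp add: M_def)
  obtain t0 where t0: "\<And>t v. t \<ge> t0 \<Longrightarrow> v \<in> family_group X \<Longrightarrow> norm (v - t *\<^sub>R z) \<le> total_norm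
    \<Longrightarrow> v \<in> family_semigroup X"
    using group_near_interior[OF assms(2)] by blast
  define p where "p = max 0 t0"
  have bound: "(real k / s - p - 1) * M \<le> ln (real (cone_mult X (real k *\<^sub>R ?\<theta>)))" for k
  proof -
    obtain y where y: "y \<in> family_semigroup X" "norm (real k *\<^sub>R ?\<theta> - y) \<le> total_norm"
      "cone_mult X (real k *\<^sub>R ?\<theta>) = word_mult X y"
      using cone_mult_obtain[OF family_cone_scale[OF cone, of "real k"]] by auto
    show ?thesis
    proof (cases "real k / s \<ge> p")
      case True
      \<comment> \<open>Stopping \<open>p\<close> short of \<open>k / s\<close> leaves the remainder
        near a multiple of \<open>z\<close> by at least \<open>t0\<close>, as
        \<open>group_near_interior\<close> requires.\<close>
      define q where "q = nat \<lfloor>real k / s - p\<rfloor>"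
      have q: "real q \<le> real k / s - p" "real k / s - p - 1 \<le> real q"
        using True by (auto simp: q_def)
      define v where "v = y - real q *\<^sub>R z"
      have "v - (real k / s - real q) *\<^sub>R z = - (real k *\<^sub>R ?\<theta> - y)"
        by (simp add: v_def s_def scaleR_diff_left divide_inverse)
      then have "norm (v - (real k / s - real q) *\<^sub>R z) \<le> total_norm"
        using y(2) by (simp only: norm_minus_cancel)
      moreover have "v \<in> family_group X"
        unfolding v_def using y(1) family_semigroup_scale[OF assms(1)] family_semigroup_subset_group
        by (blast intro: family_group_diff)
      ultimately have "v \<in> family_semigroup X"
        using q(1) by (intro t0[of "real k / s - real q"]) (auto simp: p_def)
      then have "word_mult X z ^ q \<le> word_mult X (real q *\<^sub>R z) * word_mult X v"
        using word_mult_power[of z q] word_mult_pos[of v] mult_le_mono by fastforce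
      also have "\<dots> \<le> word_mult X y"
        using word_mult_super[of "real q *\<^sub>R z" v] by (simp add: v_def)
      finally have "real (word_mult X z) ^ q \<le> real (word_mult X y)"
        by (simp flip: of_nat_power)
      then have "ln (real (word_mult X z) ^ q) \<le> ln (real (word_mult X y))"
        using word_mult_pos[OF assms(1)] by (intro ln_mono) auto
      then have "real q * M \<le> ln (real (word_mult X y))"
        using word_mult_pos[OF assms(1)] by (simp add: M_def ln_realpow)
      moreover have "(real k / s - p - 1) * M \<le> real q * M"
        using q(2) \<open>M \<ge> 0\<close> by (rule mult_right_mono)
      ultimately show ?thesis
        unfolding y(3) by linarith
    next
      case False
      then have "(real k / s - p - 1) * M \<le> 0"
        using \<open>M \<ge> 0\<close> by (intro mult_nonpos_nonneg) auto
      also have "0 \<le> ln (real (word_mult X y))"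
        using word_mult_pos[OF y(1)] by simp
      finally show ?thesis
        unfolding y(3) .
    qed
  qed
  have "(\<lambda>k. 1 / real k * ((real k / s - p - 1) * M)) \<longlonglongrightarrow> inverse s * M"
    using s by real_asymp
  then have "inverse s * M \<le> dir_growth X ?\<theta>"
    using dir_growth_tendsto[OF interior]
    by (rule LIMSEQ_le) (intro exI allI impI mult_left_mono bound, simp)
  then show ?thesis
    using s by (simp add: field_simps flip: M_def s_def)
qed

end

section \<open>Comparison of two families\<close>

lemma exp_sum_le_if_same_dir_growth:
  assumes "coplanar_family X \<eta>" "coplanar_family Y \<eta>" "same_dir_growth X Y"
  shows "coplanar_family.Z X b \<le> coplanar_family.Z Y b"
proof -
  interpret X: coplanar_family X \<eta> by fact
  interpret Y: coplanar_family Y \<eta> by fact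
  let ?S = "\<Sum>j<length X. X ! j" and ?m = "real (length X)"
  \<comment> \<open>The change of the upper estimate for \<open>Y\<close> when \<open>z\<close> is
    replaced by \<open>z + ?S\<close>; it does not depend on \<open>n\<close>.\<close>
  define C where "C = ?m * ln (Y.Z b) - b \<bullet> ?S"
  have S: "?S \<in> family_semigroup X"
    unfolding family_semigroup_def by (auto intro!: exI[of _ "\<lambda>_. 1"])
  have eta_S: "\<eta> \<bullet> ?S = ?m"
    by (simp add: inner_sum_right X.coplanar)
  have bound: "ln (X.Z b) - ln (Y.Z b) \<le> (?m * ln (real n + 1) + C) / real n" if "n > 0" for n
  proof -
    obtain z where z: "z \<in> family_semigroup X" "\<eta> \<bullet> z = real n"
      "real n * ln (X.Z b) \<le> ln (real (word_mult X z)) + b \<bullet> z + ?m * ln (real n + 1)"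
      using X.exists_large_word_mult by blast
    define y where "y = z + ?S"
    let ?\<theta> = "y /\<^sub>R norm y"
    have y: "y \<in> family_semigroup X" "y \<in> family_interior X"
      unfolding y_def by (intro family_semigroup_add z(1) S semigroup_add_sum_in_interior)+
    have eta_y: "\<eta> \<bullet> y = real n + ?m"
      by (simp add: y_def inner_add_right z(2) eta_S)
    then have "y \<noteq> 0"
      using that by auto
    have \<theta>X: "?\<theta> \<in> family_interior X"
      using y(2) \<open>y \<noteq> 0\<close> by (intro family_interior_scale) auto
    \<comment> \<open>The upper estimate for \<open>Y\<close> is available only at interior
      directions of \<open>Y\<close>; equality of the cones transfers interiority.\<close>
    then have \<theta>Y: "?\<theta> \<in> family_interior Y"
      using family_interior_subset_if_cone_eq assms(3) by (auto simp: same_dir_growth_def)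
    have "word_mult X z \<le> word_mult X z * word_mult X ?S"
      using X.word_mult_pos[OF S] by simp
    also have "\<dots> \<le> word_mult X y"
      unfolding y_def by (rule X.word_mult_super)
    finally have "ln (real (word_mult X z)) \<le> ln (real (word_mult X y))"
      using X.word_mult_pos[OF z(1)] by (intro ln_mono) auto
    also have "\<dots> \<le> norm y * dir_growth X ?\<theta>"
      using y \<open>y \<noteq> 0\<close> by (rule X.dir_growth_ge)
    also have "dir_growth X ?\<theta> = dir_growth Y ?\<theta>"
      using assms(3) \<theta>X family_interior_subset_cone[of X] \<open>y \<noteq> 0\<close>
      by (auto simp: same_dir_growth_def)
    also have "norm y * dir_growth Y ?\<theta> \<le> norm y * ((\<eta> \<bullet> ?\<theta>) * ln (Y.Z b) - b \<bullet> ?\<theta>)"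
      by (intro mult_left_mono Y.dir_growth_le[OF \<theta>Y]) simp
    also have "\<dots> = (\<eta> \<bullet> y) * ln (Y.Z b) - b \<bullet> y"
      using \<open>y \<noteq> 0\<close> by (simp add: right_diff_distrib inverse_eq_divide)
    also have "\<dots> = real n * ln (Y.Z b) + C - b \<bullet> z"
      unfolding eta_y by (simp add: C_def y_def inner_add_right algebra_simps)
    finally have "real n * (ln (X.Z b) - ln (Y.Z b)) \<le> ?m * ln (real n + 1) + C"
      using z(3) by (simp add: right_diff_distrib)
    then show ?thesis
      using that by (simp add: le_divide_eq mult.commute)
  qed
  have "(\<lambda>n::nat. (?m * ln (real n + 1) + C) / real n) \<longlonglongrightarrow> 0"
    by real_asymp
  then have "ln (X.Z b) - ln (Y.Z b) \<le> 0"
    by (rule LIMSEQ_le_const) (use bound in \<open>auto intro!: exI[of _ 1]\<close>)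
  then show ?thesis
    using X.Z_pos Y.Z_pos by simp
qed

theorem theorem1p5:
  fixes X Y :: "(real ^ 'n) list" and \<eta> :: "real ^ 'n"
  assumes "admissible_family X" and "admissible_family Y"
    and "eta_coplanar \<eta> X" and "eta_coplanar \<eta> Y"
    and "same_dir_growth X Y"
  shows "length X = length Y \<and> (\<exists>p. p permutes {..<length Y} \<and> X = permute_list p Y)"
proof -
  have fam: "coplanar_family W \<eta>" if "admissible_family W" "eta_coplanar \<eta> W" for W
  proof
    \<comment> \<open>A nonzero vector exists, so the empty family cannot span.\<close>
    have "(axis undefined 1 :: real ^ 'n) \<notin> span {}"
      by simp
    then show "W \<noteq> []"
      using that(1) by (auto simp: admissible_family_def)
  qed (use that in \<open>auto simp: admissible_family_def eta_coplanar_def\<close>)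
  interpret X: coplanar_family X \<eta> by (rule fam) fact+
  interpret Y: coplanar_family Y \<eta> by (rule fam) fact+
  have "same_dir_growth Y X"
    using assms(5) by (auto simp: same_dir_growth_def)
  then have "X.Z b = Y.Z b" for b
    using exp_sum_le_if_same_dir_growth X.coplanar_family_axioms Y.coplanar_family_axioms assms(5)
    by (intro antisym) blast+
  then have mset: "mset X = mset Y"
    unfolding X.Z_def Y.Z_def by (rule mset_eq_if_exp_sums_eq)
  then obtain p where "p permutes {..<length Y}" "permute_list p Y = X"
    by (rule mset_eq_permutation)
  with mset show ?thesis
    by (auto dest: mset_eq_length)
qed

end
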